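(* The normalised extremal quasi-modular form $f_{1,14}$ of weight $14$ and depth $\leq 1$ has integral $q$-expansion: $f_{1,14}\in\mathbb{Z}[[q]]$.
   Context: Let $q=e^{2\pi iz}$ and $E_2=1-24\sum_{n\ge1}\sigma_1(n)q^n$, $E_4=1+240\sum_{n\ge1}\sigma_3(n)q^n$, $E_6=1-504\sum_{n\ge1}\sigma_5(n)q^n$, with $\sigma_k(n)=\sum_{d\mid n}d^k$. Quasi-modular forms of weight $w$ and depth $\leq l$ are elements of $\mathbb{C}[E_2,E_4,E_6]$ homogeneous of weight $w$ (weights $2,4,6$) and of degree $\le l$ in $E_2$, identified with their $q$-expansions. $f_{1,14}$ is the unique non-zero quasi-modular form of weight $14$ and depth $\leq 1$ whose order of vanishing at $q=0$ is maximal among all non-zero such forms (this maximal order is $2$) and whose first non-zero $q$-coefficient is $1$. *)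

theory Defs
  imports Complex_Main "HOL-Computational_Algebra.Formal_Power_Series"
begin

definition divisor_sigma :: "nat \<Rightarrow> nat \<Rightarrow> nat" where
  "divisor_sigma k n = (\<Sum>d | d dvd n. d ^ k)"

text \<open>
  Eisenstein series as formal power series in \<open>q\<close>. The coefficient at \<open>0\<close> is treated
  separately because the divisors of \<open>0\<close> form an infinite set.
\<close>

definition sigma_series :: "nat \<Rightarrow> complex fps" where
  "sigma_series k = Abs_fps (\<lambda>n. if n = 0 then 0 else of_nat (divisor_sigma k n))"

definition E2 :: "complex fps" where
  "E2 = 1 - 24 * sigma_series 1"

definition E4 :: "complex fps" where
  "E4 = 1 + 240 * sigma_series 3"

definition E6 :: "complex fps" where
  "E6 = 1 - 504 * sigma_series 5"

text \<open>
  A polynomial in \<open>E2\<close>, \<open>E4\<close>, \<open>E6\<close>, homogeneous of weight \<open>w\<close> and of degree at most \<open>l\<close>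
  in \<open>E2\<close>, is given by its coefficients at the finitely many admissible exponent triples.
\<close>

definition qmf_exponents :: "nat \<Rightarrow> nat \<Rightarrow> (nat \<times> nat \<times> nat) set" where
  "qmf_exponents l w = {(a, b, c). 2 * a + 4 * b + 6 * c = w \<and> a \<le> l}"

lemma finite_qmf_exponents: "finite (qmf_exponents l w)"
  by (rule finite_subset[of _ "{..w} \<times> {..w} \<times> {..w}"]) (auto simp: qmf_exponents_def)

definition quasimodular_forms :: "nat \<Rightarrow> nat \<Rightarrow> complex fps set" where
  "quasimodular_forms l w =
     {f. \<exists>p :: nat \<times> nat \<times> nat \<Rightarrow> complex.
        f = (\<Sum>(a, b, c) \<in> qmf_exponents l w. fps_const (p (a, b, c)) * E2 ^ a * E4 ^ b * E6 ^ c)}"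

text \<open>For non-zero \<open>f\<close>, \<open>subdegree f\<close> is the order of vanishing at \<open>q = 0\<close>.\<close>

definition is_extremal :: "nat \<Rightarrow> nat \<Rightarrow> complex fps \<Rightarrow> bool" where
  "is_extremal l w f \<longleftrightarrow>
     f \<in> quasimodular_forms l w \<and> f \<noteq> 0 \<and>
     (\<forall>g \<in> quasimodular_forms l w. g \<noteq> 0 \<longrightarrow> subdegree g \<le> subdegree f)"

definition normalised_extremal :: "nat \<Rightarrow> nat \<Rightarrow> complex fps" where
  "normalised_extremal l w =
     (THE f. is_extremal l w f \<and> fps_nth f (subdegree f) = 1)"

end

theory Submission imports Defs begin

text \<open>
  Write \<open>D = q d/dq\<close> and \<open>S\<^sub>k\<close> for the series of \<open>\<sigma>\<^sub>k\<close>. By Ramanujan's formulas for \<open>D E\<^sub>4\<close> and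
  \<open>D E\<^sub>6\<close>, the form \<open>7 E\<^sub>2 E\<^sub>4\<^sup>3 + 5 E\<^sub>2 E\<^sub>6\<^sup>2 - 12 E\<^sub>4\<^sup>2 E\<^sub>6\<close>, which spans the forms of weight 14 and
  depth at most 1 vanishing to order 2, is the derivative of \<open>7 E\<^sub>4\<^sup>3 + 5 E\<^sub>6\<^sup>2\<close> (12 times the theta
  series of the Leech lattice). Subtracting the constant term and taking out \<open>5040\<close>, the normalised form is \<open>D K / 936\<close> for an
  integral \<open>K\<close>, and \<open>936 = 13 \<sdot> 72\<close>. The relation \<open>441 E\<^sub>4\<^sup>3 + 250 E\<^sub>6\<^sup>2 = 691 + 65520 S\<^sub>1\<^sub>1\<close> gives
  divisibility of \<open>K\<close> by 13. The relation \<open>E\<^sub>4\<^sup>2 = 1 + 480 S\<^sub>7\<close> rewrites \<open>K\<close> as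
  \<open>2 S\<^sub>7 - S\<^sub>3 - S\<^sub>5 + 19200 S\<^sub>3\<^sup>3 + 252 S\<^sub>5\<^sup>2\<close>, and differentiating the powers supplies the missing factors
  3 and 2, so that 72 divides \<open>D K\<close>. The four relations between Eisenstein series are convolution identities
  for divisor sums and follow, as in Liouville's method, from the bijection
  \<open>(a, b, x, y) \<mapsto> (a - b, b, x, x + y)\<close> between solutions of \<open>a x + b y = n\<close>.
\<close>

section \<open>Sums over solutions of \<open>a * x + b * y = n\<close> and over factorisations of
  \<open>n\<close>\<close>

text \<open>Integers allow the subtractions of the shear. The side condition \<open>Q\<close> sees
  all four variables but the summand only \<open>a\<close> and \<open>b\<close>, so a change of
  variables turns conditions on \<open>x, y\<close> into conditions on \<open>a, b\<close>.\<close>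

definition conv_sum :: "int \<Rightarrow> (int \<Rightarrow> int \<Rightarrow> int \<Rightarrow> int \<Rightarrow> bool) \<Rightarrow> (int \<Rightarrow> int \<Rightarrow> int) \<Rightarrow> int" where
  "conv_sum n Q F = (\<Sum>(a, b, x, y) | 0 < a \<and> 0 < b \<and> 0 < x \<and> 0 < y \<and> a * x + b * y = n \<and> Q a b x y. F a b)"

definition div_sum :: "int \<Rightarrow> (int \<Rightarrow> int \<Rightarrow> int) \<Rightarrow> int" where
  "div_sum n G = (\<Sum>(d, e) | 0 < d \<and> 0 < e \<and> d * e = n. G d e)"

abbreviation conv_sum_all :: "int \<Rightarrow> (int \<Rightarrow> int \<Rightarrow> int) \<Rightarrow> int" where
  "conv_sum_all n F \<equiv> conv_sum n (\<lambda>a b x y. True) F"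

lemma le_mult_pos: "0 < a \<Longrightarrow> 0 < x \<Longrightarrow> a \<le> a * x \<and> x \<le> a * x" for a x :: int
  by (simp add: mult_le_cancel_left1 mult_le_cancel_right1)

lemma finite_conv_sum_set:
  "finite {(a, b, x, y). 0 < a \<and> 0 < b \<and> 0 < x \<and> 0 < y \<and> a * x + b * y = n \<and> Q a b x y}"
  for n :: int
proof (rule finite_subset)
  show "{(a, b, x, y). 0 < a \<and> 0 < b \<and> 0 < x \<and> 0 < y \<and> a * x + b * y = n \<and> Q a b x y}
      \<subseteq> {0..n} \<times> {0..n} \<times> {0..n} \<times> {0..n}"
  proof clarsimp
    fix a b x y :: int
    assume "0 < a" "0 < b" "0 < x" "0 < y"
    then show "a \<le> a * x + b * y \<and> b \<le> a * x + b * y \<and> x \<le> a * x + b * y \<and> y \<le> a * x + b * y"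
      using le_mult_pos[of a x] le_mult_pos[of b y] by linarith
  qed
qed auto

lemma finite_div_sum_set: "finite {(d, e). 0 < d \<and> 0 < e \<and> d * e = n}" for n :: int
  by (rule finite_subset[of _ "{0..n} \<times> {0..n}"]) (use le_mult_pos in auto)

lemma conv_sum_split:
  "conv_sum n Q F = conv_sum n (\<lambda>a b x y. Q a b x y \<and> R a b x y) F + conv_sum n (\<lambda>a b x y. Q a b x y \<and> \<not> R a b x y) F"
  unfolding conv_sum_def
  by (subst sum.union_disjoint[symmetric])
    (auto intro!: sum.cong finite_subset[OF _ finite_conv_sum_set[where Q = Q and n = n]])

lemma conv_sum_cong:
  assumes "\<And>a b x y. 0 < a \<Longrightarrow> 0 < b \<Longrightarrow> 0 < x \<Longrightarrow> 0 < y \<Longrightarrow> a * x + b * y = n \<Longrightarrow> Q a b x y = R a b x y"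
    and "\<And>a b. F a b = G a b"
  shows "conv_sum n Q F = conv_sum n R G"
  unfolding conv_sum_def by (rule sum.cong) (use assms in auto)

lemma conv_sum_add: "conv_sum n Q (\<lambda>a b. F a b + G a b) = conv_sum n Q F + conv_sum n Q G"
  by (simp add: conv_sum_def sum.distrib case_prod_unfold)

lemma conv_sum_diff: "conv_sum n Q (\<lambda>a b. F a b - G a b) = conv_sum n Q F - conv_sum n Q G"
  by (simp add: conv_sum_def sum_subtractf case_prod_unfold)

lemma conv_sum_cmult: "conv_sum n Q (\<lambda>a b. c * F a b) = c * conv_sum n Q F"
  by (simp add: conv_sum_def sum_distrib_left case_prod_unfold)

lemma div_sum_add: "div_sum n (\<lambda>a b. F a b + G a b) = div_sum n F + div_sum n G"
  by (simp add: div_sum_def sum.distrib case_prod_unfold)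

lemma div_sum_diff: "div_sum n (\<lambda>a b. F a b - G a b) = div_sum n F - div_sum n G"
  by (simp add: div_sum_def sum_subtractf case_prod_unfold)

lemma div_sum_cmult: "div_sum n (\<lambda>a b. c * F a b) = c * div_sum n F"
  by (simp add: div_sum_def sum_distrib_left case_prod_unfold)

lemma div_sum_cong:
  assumes "\<And>d e. 0 < d \<Longrightarrow> 0 < e \<Longrightarrow> d * e = n \<Longrightarrow> F d e = G d e"
  shows "div_sum n F = div_sum n G"
  unfolding div_sum_def by (rule sum.cong) (use assms in auto)

section \<open>Symmetries of the solution set and its diagonals\<close>

lemma conv_sum_swap: "conv_sum n Q F = conv_sum n (\<lambda>a b x y. Q b a y x) (\<lambda>a b. F b a)"
  unfolding conv_sum_def
  by (rule sum.reindex_bij_witness[where i = "\<lambda>(a, b, x, y). (b, a, y, x)"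
        and j = "\<lambda>(a, b, x, y). (b, a, y, x)"]) (auto simp: algebra_simps)

text \<open>The value of the form is preserved, since
  \<open>(a - b) * x + b * (x + y) = a * x + b * y\<close>, and positivity of \<open>a - b\<close>
  becomes the condition \<open>b < a\<close>.\<close>

lemma conv_sum_shear:
  "conv_sum n (\<lambda>a b x y. x < y) F = conv_sum n (\<lambda>a b x y. b < a) (\<lambda>a b. F (a - b) b)"
  unfolding conv_sum_def
  by (rule sum.reindex_bij_witness[where i = "\<lambda>(a, b, x, y). (a - b, b, x, x + y)"
        and j = "\<lambda>(a, b, x, y). (a + b, b, x, y - x)"]) (auto simp: algebra_simps)

text \<open>For \<open>x = y = e\<close> the equation is \<open>(a + b) * e = n\<close>, so
  \<open>a\<close> runs over the ways to split the divisor \<open>d = a + b\<close>.\<close>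

lemma conv_sum_diag_eq_second:
  "conv_sum n (\<lambda>a b x y. x = y) F = div_sum n (\<lambda>d e. \<Sum>a\<in>{1..<d}. F a (d - a))"
proof -
  have "div_sum n (\<lambda>d e. \<Sum>a\<in>{1..<d}. F a (d - a)) =
     (\<Sum>((d, e), a) \<in> Sigma {(d, e). 0 < d \<and> 0 < e \<and> d * e = n} (\<lambda>(d, e). {1..<d}). F a (d - a))"
    unfolding div_sum_def case_prod_unfold
    by (subst sum.Sigma) (use finite_div_sum_set[of n] in \<open>auto simp: case_prod_unfold\<close>)
  also have "\<dots> = conv_sum n (\<lambda>a b x y. x = y) F"
    unfolding conv_sum_def
    by (rule sum.reindex_bij_witness[where i = "\<lambda>(a, b, x, y). ((a + b, x), a)"
        and j = "\<lambda>((d, e), a). (a, d - a, e, e)"]) (auto simp: algebra_simps)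
  finally show ?thesis ..
qed

text \<open>For \<open>a = b = d\<close> the equation is \<open>d * (x + y) = n\<close>, and the
  codivisor \<open>e = x + y\<close> splits in \<open>e - 1\<close> ways.\<close>

lemma conv_sum_diag_eq_first:
  "conv_sum n (\<lambda>a b x y. a = b) F = div_sum n (\<lambda>d e. (e - 1) * F d d)"
proof -
  have "div_sum n (\<lambda>d e. (e - 1) * F d d) = div_sum n (\<lambda>d e. \<Sum>x\<in>{1..<e}. F d d)"
    by (rule div_sum_cong) simp
  also have "\<dots> =
     (\<Sum>((d, e), x) \<in> Sigma {(d, e). 0 < d \<and> 0 < e \<and> d * e = n} (\<lambda>(d, e). {1..<e}). F d d)"
    unfolding div_sum_def case_prod_unfold
    by (subst sum.Sigma) (use finite_div_sum_set[of n] in \<open>auto simp: case_prod_unfold\<close>)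
  also have "\<dots> = conv_sum n (\<lambda>a b x y. a = b) F"
    unfolding conv_sum_def
    by (rule sum.reindex_bij_witness[where i = "\<lambda>(a, b, x, y). ((a, x + y), x)"
        and j = "\<lambda>((d, e), x). (d, d, x, e - x)"]) (auto simp: algebra_simps)
  finally show ?thesis ..
qed

lemma conv_sum_symmetric_second:
  assumes "\<And>a b. F b a = F a b"
  shows "conv_sum_all n F = 2 * conv_sum n (\<lambda>a b x y. x < y) F + conv_sum n (\<lambda>a b x y. x = y) F"
proof -
  have "conv_sum_all n F = conv_sum n (\<lambda>a b x y. x < y) F + conv_sum n (\<lambda>a b x y. \<not> x < y) F"
    by (subst conv_sum_split[where R = "\<lambda>a b x y. x < y"]) simp
  also have "conv_sum n (\<lambda>a b x y. \<not> x < y) F =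
      conv_sum n (\<lambda>a b x y. y < x) F + conv_sum n (\<lambda>a b x y. x = y) F"
    by (subst conv_sum_split[where R = "\<lambda>a b x y. y < x"])
       (intro arg_cong2[where f = "(+)"] conv_sum_cong; auto)
  also have "conv_sum n (\<lambda>a b x y. y < x) F = conv_sum n (\<lambda>a b x y. x < y) F"
    by (subst conv_sum_swap) (simp add: assms)
  finally show ?thesis by simp
qed

lemma conv_sum_symmetric_first:
  assumes "\<And>a b. F b a = F a b"
  shows "conv_sum_all n F = 2 * conv_sum n (\<lambda>a b x y. b < a) F + conv_sum n (\<lambda>a b x y. a = b) F"
proof -
  have "conv_sum_all n F = conv_sum n (\<lambda>a b x y. b < a) F + conv_sum n (\<lambda>a b x y. \<not> b < a) F"
    by (subst conv_sum_split[where R = "\<lambda>a b x y. b < a"]) simp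
  also have "conv_sum n (\<lambda>a b x y. \<not> b < a) F =
      conv_sum n (\<lambda>a b x y. a < b) F + conv_sum n (\<lambda>a b x y. a = b) F"
    by (subst conv_sum_split[where R = "\<lambda>a b x y. a < b"])
       (intro arg_cong2[where f = "(+)"] conv_sum_cong; auto)
  also have "conv_sum n (\<lambda>a b x y. a < b) F = conv_sum n (\<lambda>a b x y. b < a) F"
    by (subst conv_sum_swap) (simp add: assms)
  finally show ?thesis by simp
qed

text \<open>The shear conjugated by the swap of the two products.\<close>

lemma conv_sum_shear_mirror:
  "conv_sum n (\<lambda>a b x y. y < x) F = conv_sum n (\<lambda>a b x y. a < b) (\<lambda>a b. F a (b - a))"
  by (subst conv_sum_swap, subst conv_sum_shear, subst conv_sum_swap) simp

text \<open>
  The sheared sum over \<open>x > y\<close> is a sum over \<open>a < b\<close>, so restricting \<open>G\<close> to \<open>x < y\<close> costs only boundary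
  terms once \<open>G a b - G a (b - a)\<close> is summed without restriction.
\<close>

lemma conv_sum_telescope:
  "conv_sum n (\<lambda>a b x y. x < y) G =
     conv_sum_all n (\<lambda>a b. G a b - G a (b - a)) + conv_sum n (\<lambda>a b x y. b < a) (\<lambda>a b. G a (b - a))
     + conv_sum n (\<lambda>a b x y. a = b) (\<lambda>a b. G a 0) - conv_sum n (\<lambda>a b x y. x = y) G"
proof -
  have 1: "conv_sum_all n G = conv_sum n (\<lambda>a b x y. y < x) G + conv_sum n (\<lambda>a b x y. \<not> y < x) G"
    by (subst conv_sum_split[where R = "\<lambda>a b x y. y < x"]) simp
  have 2: "conv_sum n (\<lambda>a b x y. \<not> y < x) G =
      conv_sum n (\<lambda>a b x y. x < y) G + conv_sum n (\<lambda>a b x y. x = y) G"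
    by (subst conv_sum_split[where R = "\<lambda>a b x y. x < y"])
       (intro arg_cong2[where f = "(+)"] conv_sum_cong; auto)
  let ?H = "\<lambda>a b. G a (b - a)"
  have 3: "conv_sum_all n ?H = conv_sum n (\<lambda>a b x y. a < b) ?H + conv_sum n (\<lambda>a b x y. \<not> a < b) ?H"
    by (subst conv_sum_split[where R = "\<lambda>a b x y. a < b"]) simp
  have 4: "conv_sum n (\<lambda>a b x y. \<not> a < b) ?H =
      conv_sum n (\<lambda>a b x y. b < a) ?H + conv_sum n (\<lambda>a b x y. a = b) ?H"
    by (subst conv_sum_split[where R = "\<lambda>a b x y. b < a"])
       (intro arg_cong2[where f = "(+)"] conv_sum_cong; auto)
  have 5: "conv_sum n (\<lambda>a b x y. a = b) ?H = conv_sum n (\<lambda>a b x y. a = b) (\<lambda>a b. G a 0)"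
    by (simp add: conv_sum_diag_eq_first)
  show ?thesis
    using 1 2 3 4 5 conv_sum_shear_mirror[of n G] by (simp add: conv_sum_diff)
qed

section \<open>Liouville's identities for an even function\<close>

text \<open>By symmetry and the shear, the sum of \<open>f (a - b)\<close> is twice that of
  \<open>f a\<close> over \<open>x < y\<close>, and the sum of \<open>f (a + b)\<close> is, up to a
  diagonal, twice that of \<open>f a\<close> over \<open>b < a\<close>. As \<open>f a\<close> does
  not depend on \<open>b\<close>, the telescoping identity equates these two up to diagonals, which
  form the right-hand side.\<close>

lemma liouville_first:
  assumes even: "\<And>x. f (- x) = f x" and "f 0 = 0"
  shows "conv_sum_all n (\<lambda>a b. f (a - b)) - conv_sum_all n (\<lambda>a b. f (a + b)) =
    div_sum n (\<lambda>d e. (2 * e - d - 1) * f d - 2 * (\<Sum>a\<in>{1..<d}. f a))"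
proof -
  have sym: "f (b - a) = f (a - b)" for a b
    using even[of "a - b"] by simp
  have 1: "conv_sum_all n (\<lambda>a b. f (a - b)) = 2 * conv_sum n (\<lambda>a b x y. b < a) (\<lambda>a b. f (a - b))"
    by (subst conv_sum_symmetric_first) (auto simp: sym conv_sum_diag_eq_first assms div_sum_def)
  have 2: "conv_sum n (\<lambda>a b x y. b < a) (\<lambda>a b. f (a - b)) = conv_sum n (\<lambda>a b x y. x < y) (\<lambda>a b. f a)"
    by (rule conv_sum_shear[symmetric])
  have 3: "conv_sum n (\<lambda>a b x y. x < y) (\<lambda>a b. f a) = conv_sum n (\<lambda>a b x y. b < a) (\<lambda>a b. f a)
      + div_sum n (\<lambda>d e. (e - 1) * f d) - div_sum n (\<lambda>d e. \<Sum>a\<in>{1..<d}. f a)"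
    by (subst conv_sum_telescope) (simp add: conv_sum_diag_eq_first conv_sum_diag_eq_second, simp add: conv_sum_def)
  have 4: "conv_sum_all n (\<lambda>a b. f (a + b)) = 2 * conv_sum n (\<lambda>a b x y. b < a) (\<lambda>a b. f a)
      + div_sum n (\<lambda>d e. (d - 1) * f d)"
  proof (subst conv_sum_symmetric_second)
    show "2 * conv_sum n (\<lambda>a b x y. x < y) (\<lambda>a b. f (a + b)) + conv_sum n (\<lambda>a b x y. x = y) (\<lambda>a b. f (a + b)) =
      2 * conv_sum n (\<lambda>a b x y. b < a) (\<lambda>a b. f a) + div_sum n (\<lambda>d e. (d - 1) * f d)"
      by (subst conv_sum_shear) (auto simp: conv_sum_diag_eq_second intro!: div_sum_cong)
  qed (simp add: add.commute)
  have "div_sum n (\<lambda>d e. (2 * e - d - 1) * f d - 2 * (\<Sum>a\<in>{1..<d}. f a)) =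
    div_sum n (\<lambda>d e. 2 * ((e - 1) * f d) - 2 * (\<Sum>a\<in>{1..<d}. f a) - (d - 1) * f d)"
    by (rule div_sum_cong) (simp add: algebra_simps)
  then show ?thesis
    using 1 2 3 4 by (simp add: div_sum_diff div_sum_cmult)
qed

text \<open>
  Applying the telescoping identity to \<open>(a + b) b f(a)\<close> produces the term \<open>(b - a) b f(a)\<close> over \<open>b < a\<close>, which cancels
  the one coming from \<open>f(a + b)\<close>.
\<close>

lemma liouville_second:
  assumes even: "\<And>x. f (- x) = f x" and "f 0 = 0"
  shows "conv_sum_all n (\<lambda>a b. a * b * f (a + b)) + conv_sum_all n (\<lambda>a b. a * b * f (a - b)) =
    4 * conv_sum_all n (\<lambda>a b. a * b * f a) +
    div_sum n (\<lambda>d e. f d * (\<Sum>a\<in>{1..<d}. a * (d - a)) - 2 * (\<Sum>a\<in>{1..<d}. d * (d - a) * f a))"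
proof -
  have sym: "f (b - a) = f (a - b)" for a b
    using even[of "a - b"] by simp
  have 1: "conv_sum_all n (\<lambda>a b. a * b * f (a - b)) =
      2 * conv_sum n (\<lambda>a b x y. b < a) (\<lambda>a b. a * b * f (a - b))"
    by (subst conv_sum_symmetric_first) (auto simp: sym conv_sum_diag_eq_first assms div_sum_def)
  let ?G = "\<lambda>a b. (a + b) * b * f a"
  have 2: "conv_sum n (\<lambda>a b x y. b < a) (\<lambda>a b. a * b * f (a - b)) = conv_sum n (\<lambda>a b x y. x < y) ?G"
    by (subst conv_sum_shear) simp
  have 3: "conv_sum n (\<lambda>a b x y. x < y) ?G = 2 * conv_sum_all n (\<lambda>a b. a * b * f a)
      - conv_sum n (\<lambda>a b x y. b < a) (\<lambda>a b. (a - b) * b * f a)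
      - div_sum n (\<lambda>d e. \<Sum>a\<in>{1..<d}. d * (d - a) * f a)"
  proof -
    \<comment> \<open>Here \<open>(a + b) * b - b * (b - a) = 2 * a * b\<close>.\<close>
    have "conv_sum_all n (\<lambda>a b. ?G a b - ?G a (b - a)) = 2 * conv_sum_all n (\<lambda>a b. a * b * f a)"
      by (subst conv_sum_cmult[symmetric], rule conv_sum_cong) (auto simp: algebra_simps)
    moreover have "conv_sum n (\<lambda>a b x y. b < a) (\<lambda>a b. ?G a (b - a)) =
        - conv_sum n (\<lambda>a b x y. b < a) (\<lambda>a b. (a - b) * b * f a)"
      using conv_sum_cmult[of n "\<lambda>a b x y. b < a" "-1" "\<lambda>a b. (a - b) * b * f a"]
      by (simp add: algebra_simps)
    moreover have "conv_sum n (\<lambda>a b x y. a = b) (\<lambda>a b. ?G a 0) = 0"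
      by (simp add: conv_sum_def)
    moreover have "conv_sum n (\<lambda>a b x y. x = y) ?G = div_sum n (\<lambda>d e. \<Sum>a\<in>{1..<d}. d * (d - a) * f a)"
      by (simp add: conv_sum_diag_eq_second)
    ultimately show ?thesis
      by (subst conv_sum_telescope) simp
  qed
  have 4: "conv_sum_all n (\<lambda>a b. a * b * f (a + b)) =
      2 * conv_sum n (\<lambda>a b x y. b < a) (\<lambda>a b. (a - b) * b * f a)
      + div_sum n (\<lambda>d e. f d * (\<Sum>a\<in>{1..<d}. a * (d - a)))"
  proof (subst conv_sum_symmetric_second)
    show "2 * conv_sum n (\<lambda>a b x y. x < y) (\<lambda>a b. a * b * f (a + b))
        + conv_sum n (\<lambda>a b x y. x = y) (\<lambda>a b. a * b * f (a + b)) =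
      2 * conv_sum n (\<lambda>a b x y. b < a) (\<lambda>a b. (a - b) * b * f a)
        + div_sum n (\<lambda>d e. f d * (\<Sum>a\<in>{1..<d}. a * (d - a)))"
      by (subst conv_sum_shear)
        (auto simp: conv_sum_diag_eq_second sum_distrib_left mult_ac intro!: div_sum_cong)
  qed (simp add: add.commute mult.commute)
  show ?thesis
    using 1 2 3 4 by (simp add: div_sum_diff div_sum_cmult)
qed

section \<open>Faulhaber's formulas for sums up to \<open>d - 1\<close>, cleared of
  denominators\<close>

lemma sum_power1:
  fixes d :: int
  assumes "0 < d"
  shows "2 * (\<Sum>a\<in>{1..<d}. a) = d ^ 2 - d"
proof -
  have "1 \<le> d" using assms by simp
  then show ?thesis
  proof (induction rule: int_ge_induct)
    case (step i)
    then have "{1..<i + 1} = insert i {1..<i}" by auto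
    with step show ?case
      by (simp add: algebra_simps power_numeral_reduce)
  qed simp
qed

lemma sum_power2:
  fixes d :: int
  assumes "0 < d"
  shows "6 * (\<Sum>a\<in>{1..<d}. a ^ 2) = 2 * d ^ 3 - 3 * d ^ 2 + d"
proof -
  have "1 \<le> d" using assms by simp
  then show ?thesis
  proof (induction rule: int_ge_induct)
    case (step i)
    then have "{1..<i + 1} = insert i {1..<i}" by auto
    with step show ?case
      by (simp add: algebra_simps power_numeral_reduce)
  qed simp
qed

lemma sum_power4:
  fixes d :: int
  assumes "0 < d"
  shows "30 * (\<Sum>a\<in>{1..<d}. a ^ 4) = 6 * d ^ 5 - 15 * d ^ 4 + 10 * d ^ 3 - d"
proof -
  have "1 \<le> d" using assms by simp
  then show ?thesis
  proof (induction rule: int_ge_induct)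
    case (step i)
    then have "{1..<i + 1} = insert i {1..<i}" by auto
    with step show ?case
      by (simp add: algebra_simps power_numeral_reduce)
  qed simp
qed

lemma sum_power5:
  fixes d :: int
  assumes "0 < d"
  shows "12 * (\<Sum>a\<in>{1..<d}. a ^ 5) = 2 * d ^ 6 - 6 * d ^ 5 + 5 * d ^ 4 - d ^ 2"
proof -
  have "1 \<le> d" using assms by simp
  then show ?thesis
  proof (induction rule: int_ge_induct)
    case (step i)
    then have "{1..<i + 1} = insert i {1..<i}" by auto
    with step show ?case
      by (simp add: algebra_simps power_numeral_reduce)
  qed simp
qed

lemma sum_power6:
  fixes d :: int
  assumes "0 < d"
  shows "42 * (\<Sum>a\<in>{1..<d}. a ^ 6) = 6 * d ^ 7 - 21 * d ^ 6 + 21 * d ^ 5 - 7 * d ^ 3 + d"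
proof -
  have "1 \<le> d" using assms by simp
  then show ?thesis
  proof (induction rule: int_ge_induct)
    case (step i)
    then have "{1..<i + 1} = insert i {1..<i}" by auto
    with step show ?case
      by (simp add: algebra_simps power_numeral_reduce)
  qed simp
qed

lemma sum_power8:
  fixes d :: int
  assumes "0 < d"
  shows "90 * (\<Sum>a\<in>{1..<d}. a ^ 8) = 10 * d ^ 9 - 45 * d ^ 8 + 60 * d ^ 7 - 42 * d ^ 5 + 20 * d ^ 3 - 3 * d"
proof -
  have "1 \<le> d" using assms by simp
  then show ?thesis
  proof (induction rule: int_ge_induct)
    case (step i)
    then have "{1..<i + 1} = insert i {1..<i}" by auto
    with step show ?case
      by (simp add: algebra_simps power_numeral_reduce)
  qed simp
qed

lemma sum_power9:
  fixes d :: int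
  assumes "0 < d"
  shows "20 * (\<Sum>a\<in>{1..<d}. a ^ 9) = 2 * d ^ 10 - 10 * d ^ 9 + 15 * d ^ 8 - 14 * d ^ 6 + 10 * d ^ 4 - 3 * d ^ 2"
proof -
  have "1 \<le> d" using assms by simp
  then show ?thesis
  proof (induction rule: int_ge_induct)
    case (step i)
    then have "{1..<i + 1} = insert i {1..<i}" by auto
    with step show ?case
      by (simp add: algebra_simps power_numeral_reduce)
  qed simp
qed

lemma sum_mult_diff:
  fixes d :: int
  assumes "0 < d"
  shows "6 * (\<Sum>a\<in>{1..<d}. a * (d - a)) = d ^ 3 - d"
proof -
  have "(\<Sum>a\<in>{1..<d}. a * (d - a)) = d * (\<Sum>a\<in>{1..<d}. a) - (\<Sum>a\<in>{1..<d}. a ^ 2)"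
    by (simp add: sum_distrib_left sum_subtractf[symmetric] algebra_simps power2_eq_square)
  moreover have "6 * (d * (\<Sum>a\<in>{1..<d}. a)) = 3 * d * (d ^ 2 - d)"
    using sum_power1[OF assms] by simp
  moreover have "3 * d * (d ^ 2 - d) - (2 * d ^ 3 - 3 * d ^ 2 + d) = d ^ 3 - d"
    by algebra
  ultimately show ?thesis
    using sum_power2[OF assms] by (simp only: right_diff_distrib)
qed

lemma sum_mult_diff_power:
  "(\<Sum>a\<in>{1..<d}. d * (d - a) * a ^ k) =
     d ^ 2 * (\<Sum>a\<in>{1..<d}. a ^ k) - d * (\<Sum>a\<in>{1..<d}. a ^ Suc k)" for d :: int
  by (simp add: sum_distrib_left sum_subtractf[symmetric] algebra_simps power2_eq_square)

section \<open>Convolution identities for the divisor-sum series\<close>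

unbundle fps_syntax

text \<open>No separate case for the constant term is required: \<open>0\<close> is not a product of
  two positive integers, so the sum there is empty.\<close>

definition S :: "nat \<Rightarrow> int fps" where
  "S k = Abs_fps (\<lambda>n. div_sum (int n) (\<lambda>d e. d ^ k))"

lemma S_nth: "S k $ n = div_sum (int n) (\<lambda>d e. d ^ k)"
  by (simp add: S_def)

lemma weighted_sum_split:
  fixes a b x y :: int
  assumes "0 < a" "0 < b" "0 < x" "0 < y" "a * x + b * y = int n"
  shows "nat (a * x) \<le> n" "int (n - nat (a * x)) = b * y"
proof -
  have "0 < a * x" "0 < b * y" using assms by simp_all
  then show "nat (a * x) \<le> n" "int (n - nat (a * x)) = b * y"
    using assms(5) by linarith+
qed

text \<open>The index of the Cauchy product is \<open>k = a * x\<close>, leaving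
  \<open>b * y = n - k\<close>.\<close>

lemma S_mult_nth: "(S i * S j) $ n = conv_sum_all (int n) (\<lambda>a b. a ^ i * b ^ j)"
proof -
  let ?P = "\<lambda>m::int. {(d, e). 0 < d \<and> 0 < e \<and> d * e = m}"
  have "(S i * S j) $ n =
     (\<Sum>k\<in>{0..n}. \<Sum>(p, q)\<in>?P (int k) \<times> ?P (int (n - k)). fst p ^ i * fst q ^ j)"
    by (simp add: fps_mult_nth S_nth div_sum_def sum_product sum.cartesian_product case_prod_unfold)
  also have "\<dots> = (\<Sum>(k, p, q)\<in>Sigma {0..n} (\<lambda>k. ?P (int k) \<times> ?P (int (n - k))). fst p ^ i * fst q ^ j)"
    by (subst sum.Sigma) (use finite_div_sum_set in \<open>auto simp: case_prod_unfold\<close>)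
  also have "\<dots> = conv_sum_all (int n) (\<lambda>a b. a ^ i * b ^ j)"
    unfolding conv_sum_def
    by (rule sum.reindex_bij_witness[where i = "\<lambda>(a, b, x, y). (nat (a * x), (a, x), (b, y))"
        and j = "\<lambda>(k, (a, x), (b, y)). (a, b, x, y)"]) (auto simp: weighted_sum_split)
  finally show ?thesis .
qed

definition euler :: "int fps \<Rightarrow> int fps" where
  "euler f = fps_X * fps_deriv f"

lemma euler_nth: "euler f $ n = int n * f $ n"
  by (cases n) (simp_all add: euler_def)

text \<open>Writing the factor \<open>n\<close> as \<open>d * e\<close> gives the shape of the term
  \<open>2 * e * f d\<close> in \<open>liouville_first\<close>.\<close>

lemma euler_S_nth: "euler (S k) $ n = div_sum (int n) (\<lambda>d e. d ^ (k + 1) * e)"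
proof -
  have "euler (S k) $ n = div_sum (int n) (\<lambda>d e. int n * d ^ k)"
    by (simp add: euler_nth S_nth div_sum_cmult)
  also have "\<dots> = div_sum (int n) (\<lambda>d e. d ^ (k + 1) * e)"
    by (rule div_sum_cong) auto
  finally show ?thesis .
qed

lemma fps_numeral_mult_nth: "(numeral k * f) $ n = numeral k * f $ n" for f :: "'a::comm_ring_1 fps"
  by (simp add: numeral_fps_const)

lemma conv_sum_mono_swap: "conv_sum_all n (\<lambda>a b. a ^ j * b ^ i) = conv_sum_all n (\<lambda>a b. a ^ i * b ^ j)"
  by (subst conv_sum_swap) (simp add: mult.commute)

text \<open>The coefficient form of Ramanujan's formula for the derivative of \<open>E4\<close>. It
  is \<open>liouville_first\<close> for the fourth power, where only odd exponents of
  \<open>a\<close> and \<open>b\<close> survive.\<close>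

lemma S1_S3: "240 * (S 1 * S 3) = 21 * S 5 - 30 * euler (S 3) + 10 * S 3 - S 1"
proof (rule fps_ext)
  fix m
  let ?n = "int m" and ?U = "\<lambda>i j. conv_sum_all (int m) (\<lambda>a b. a ^ i * b ^ j)"
  have "conv_sum_all ?n (\<lambda>a b. (a - b) ^ 4) - conv_sum_all ?n (\<lambda>a b. (a + b) ^ 4) =
      conv_sum_all ?n (\<lambda>a b. (- 8) * (a ^ 1 * b ^ 3) + (- 8) * (a ^ 3 * b ^ 1))"
    unfolding conv_sum_diff[symmetric]
    by (rule conv_sum_cong) (simp_all, algebra)
  also have "\<dots> = - 16 * ?U 1 3"
    unfolding conv_sum_add conv_sum_cmult conv_sum_mono_swap[of _ 3 1] by simp
  \<comment> \<open>The factor 15 turns the doubled power sum into the multiple by 30 that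
    \<open>sum_power4\<close> evaluates.\<close>
  finally have "- 240 * ?U 1 3 = 15 * (conv_sum_all ?n (\<lambda>a b. (a - b) ^ 4) - conv_sum_all ?n (\<lambda>a b. (a + b) ^ 4))"
    by simp
  also have "\<dots> = div_sum ?n (\<lambda>d e. 15 * ((2 * e - d - 1) * d ^ 4 - 2 * (\<Sum>a\<in>{1..<d}. a ^ 4)))"
    by (subst liouville_first[where f = "\<lambda>x. x ^ 4"], simp_all only: div_sum_cmult, simp_all)
  also have "\<dots> = div_sum ?n (\<lambda>d e. 30 * (d ^ (3 + 1) * e) + d ^ 1 - 21 * d ^ 5 - 10 * d ^ 3)"
  proof (rule div_sum_cong)
    fix d e :: int assume "0 < d"
    show "15 * ((2 * e - d - 1) * d ^ 4 - 2 * (\<Sum>a\<in>{1..<d}. a ^ 4)) =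
        30 * (d ^ (3 + 1) * e) + d ^ 1 - 21 * d ^ 5 - 10 * d ^ 3"
      using sum_power4[OF \<open>0 < d\<close>] by (simp add: algebra_simps power_numeral_reduce)
  qed
  finally show "(240 * (S 1 * S 3)) $ m = (21 * S 5 - 30 * euler (S 3) + 10 * S 3 - S 1) $ m"
    by (simp only: fps_add_nth fps_sub_nth fps_numeral_mult_nth S_mult_nth S_nth euler_S_nth
        div_sum_add div_sum_diff div_sum_cmult)
qed

text \<open>The coefficient form of \<open>E4 ^ 2 = E8\<close>. In \<open>liouville_second\<close>
  for the fourth power, the terms in \<open>a ^ 5 * b\<close> cancel against the term
  \<open>4 * a * b * f a\<close>, isolating \<open>a ^ 3 * b ^ 3\<close>.\<close>

lemma S3_S3: "120 * S 3 ^ 2 = S 7 - S 3"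
proof (rule fps_ext)
  fix m
  let ?n = "int m" and ?U = "\<lambda>i j. conv_sum_all (int m) (\<lambda>a b. a ^ i * b ^ j)"
  have "conv_sum_all ?n (\<lambda>a b. a * b * (a + b) ^ 4) + conv_sum_all ?n (\<lambda>a b. a * b * (a - b) ^ 4) =
      conv_sum_all ?n (\<lambda>a b. 2 * (a ^ 5 * b ^ 1) + 12 * (a ^ 3 * b ^ 3) + 2 * (a ^ 1 * b ^ 5))"
    unfolding conv_sum_add[symmetric]
    by (rule conv_sum_cong) (simp_all, algebra)
  also have "\<dots> = 4 * ?U 5 1 + 12 * ?U 3 3"
    unfolding conv_sum_add conv_sum_cmult conv_sum_mono_swap[of _ 1 5] by simp
  finally have "120 * ?U 3 3 = 10 * (conv_sum_all ?n (\<lambda>a b. a * b * (a + b) ^ 4)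
      + conv_sum_all ?n (\<lambda>a b. a * b * (a - b) ^ 4) - 4 * ?U 5 1)"
    by simp
  also have "?U 5 1 = conv_sum_all ?n (\<lambda>a b. a * b * a ^ 4)"
    by (rule conv_sum_cong) (simp_all, algebra)
  also have "10 * (conv_sum_all ?n (\<lambda>a b. a * b * (a + b) ^ 4)
      + conv_sum_all ?n (\<lambda>a b. a * b * (a - b) ^ 4) - 4 * conv_sum_all ?n (\<lambda>a b. a * b * a ^ 4)) =
      div_sum ?n (\<lambda>d e. 10 * (d ^ 4 * (\<Sum>a\<in>{1..<d}. a * (d - a)) - 2 * (\<Sum>a\<in>{1..<d}. d * (d - a) * a ^ 4)))"
    by (subst liouville_second[where f = "\<lambda>x. x ^ 4"], simp_all only: div_sum_cmult, simp_all)
  also have "\<dots> = div_sum ?n (\<lambda>d e. d ^ 7 - d ^ 3)"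
  proof (rule div_sum_cong)
    fix d e :: int assume d: "0 < d"
    \<comment> \<open>The extra factor 6 clears the denominators of all three power sums at
      once.\<close>
    have "6 * (10 * (d ^ 4 * (\<Sum>a\<in>{1..<d}. a * (d - a)) - 2 * (\<Sum>a\<in>{1..<d}. d * (d - a) * a ^ 4))) =
      10 * d ^ 4 * (d ^ 3 - d) - 4 * d ^ 2 * (6 * d ^ 5 - 15 * d ^ 4 + 10 * d ^ 3 - d)
        + 10 * d * (2 * d ^ 6 - 6 * d ^ 5 + 5 * d ^ 4 - d ^ 2)"
      using sum_mult_diff[OF d] sum_power4[OF d] sum_power5[OF d]
      unfolding sum_mult_diff_power by (simp only: Suc_numeral semiring_norm) algebra
    also have "\<dots> = 6 * (d ^ 7 - d ^ 3)" by algebra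
    finally show "10 * (d ^ 4 * (\<Sum>a\<in>{1..<d}. a * (d - a)) - 2 * (\<Sum>a\<in>{1..<d}. d * (d - a) * a ^ 4)) =
      d ^ 7 - d ^ 3" by simp
  qed
  finally show "(120 * S 3 ^ 2) $ m = (S 7 - S 3) $ m"
    by (simp only: power2_eq_square fps_sub_nth fps_numeral_mult_nth S_mult_nth S_nth div_sum_diff)
qed

text \<open>The coefficient form of Ramanujan's formula for the derivative of \<open>E6\<close>. The
  sixth power in \<open>liouville_first\<close> also produces \<open>a ^ 3 * b ^ 3\<close>, which
  \<open>S3_S3\<close> eliminates.\<close>

lemma S1_S5: "504 * (S 1 * S 5) = 20 * S 7 + 21 * S 5 + S 1 - 42 * euler (S 5)"
proof (rule fps_ext)
  \<comment> \<open>Here \<open>p, q, r, s\<close> stand for the coefficients of \<open>S 7\<close>,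
    \<open>S 5\<close>, \<open>S 3\<close>, \<open>S 1\<close> and \<open>t\<close> for that of
    \<open>euler (S 5)\<close>; \<open>r\<close> cancels.\<close>
  have solve: "504 * u = 20 * p + 21 * q + s - 42 * t"
    if "- 504 * u - 7 * (p - r) = 42 * t - 27 * p - 21 * q + 7 * r - s" for u p q r s t :: int
    using that by algebra
  fix m
  let ?n = "int m" and ?U = "\<lambda>i j. conv_sum_all (int m) (\<lambda>a b. a ^ i * b ^ j)"
  have "conv_sum_all ?n (\<lambda>a b. (a - b) ^ 6) - conv_sum_all ?n (\<lambda>a b. (a + b) ^ 6) =
      conv_sum_all ?n (\<lambda>a b. (- 12) * (a ^ 1 * b ^ 5) + (- 40) * (a ^ 3 * b ^ 3) + (- 12) * (a ^ 5 * b ^ 1))"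
    unfolding conv_sum_diff[symmetric]
    by (rule conv_sum_cong) (simp_all, algebra)
  also have "\<dots> = - 24 * ?U 1 5 - 40 * ?U 3 3"
    unfolding conv_sum_add conv_sum_cmult conv_sum_mono_swap[of _ 5 1] by simp
  finally have "- 504 * ?U 1 5 - 7 * (120 * ?U 3 3) =
      21 * (conv_sum_all ?n (\<lambda>a b. (a - b) ^ 6) - conv_sum_all ?n (\<lambda>a b. (a + b) ^ 6))"
    by simp
  also have "\<dots> = div_sum ?n (\<lambda>d e. 21 * ((2 * e - d - 1) * d ^ 6 - 2 * (\<Sum>a\<in>{1..<d}. a ^ 6)))"
    by (subst liouville_first[where f = "\<lambda>x. x ^ 6"], simp_all only: div_sum_cmult, simp_all)
  also have "\<dots> = div_sum ?n (\<lambda>d e. 42 * (d ^ (5 + 1) * e) - 27 * d ^ 7 - 21 * d ^ 5 + 7 * d ^ 3 - d ^ 1)"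
  proof (rule div_sum_cong)
    fix d e :: int assume "0 < d"
    show "21 * ((2 * e - d - 1) * d ^ 6 - 2 * (\<Sum>a\<in>{1..<d}. a ^ 6)) =
        42 * (d ^ (5 + 1) * e) - 27 * d ^ 7 - 21 * d ^ 5 + 7 * d ^ 3 - d ^ 1"
      using sum_power6[OF \<open>0 < d\<close>] by (simp add: algebra_simps power_numeral_reduce)
  qed
  also have "120 * ?U 3 3 = (S 7 - S 3) $ m"
    unfolding S3_S3[symmetric] by (simp only: power2_eq_square fps_numeral_mult_nth S_mult_nth)
  finally have "504 * ?U 1 5 = 20 * div_sum ?n (\<lambda>d e. d ^ 7) + 21 * div_sum ?n (\<lambda>d e. d ^ 5)
      + div_sum ?n (\<lambda>d e. d ^ 1) - 42 * div_sum ?n (\<lambda>d e. d ^ (5 + 1) * e)"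
    unfolding fps_sub_nth S_nth div_sum_add div_sum_diff div_sum_cmult by (rule solve)
  then show "(504 * (S 1 * S 5)) $ m = (20 * S 7 + 21 * S 5 + S 1 - 42 * euler (S 5)) $ m"
    by (simp only: fps_add_nth fps_sub_nth fps_numeral_mult_nth S_mult_nth S_nth euler_S_nth)
qed

text \<open>The eighth power in \<open>liouville_second\<close> yields \<open>S 3 * S 7\<close> and
  \<open>S 5 ^ 2\<close> only in this combination, which is the one occurring in
  \<open>weight_12\<close>.\<close>

lemma S3_S7: "10080 * (S 3 * S 7) + 12600 * S 5 ^ 2 = 13 * S 11 - 42 * S 7 + 50 * S 5 - 21 * S 3"
proof (rule fps_ext)
  fix m
  let ?n = "int m" and ?U = "\<lambda>i j. conv_sum_all (int m) (\<lambda>a b. a ^ i * b ^ j)"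
  have "conv_sum_all ?n (\<lambda>a b. a * b * (a + b) ^ 8) + conv_sum_all ?n (\<lambda>a b. a * b * (a - b) ^ 8) =
      conv_sum_all ?n (\<lambda>a b. 2 * (a ^ 9 * b ^ 1) + 56 * (a ^ 7 * b ^ 3) + 140 * (a ^ 5 * b ^ 5)
        + 56 * (a ^ 3 * b ^ 7) + 2 * (a ^ 1 * b ^ 9))"
    unfolding conv_sum_add[symmetric]
    by (rule conv_sum_cong) (simp_all, algebra)
  also have "\<dots> = 4 * ?U 9 1 + 112 * ?U 3 7 + 140 * ?U 5 5"
    unfolding conv_sum_add conv_sum_cmult conv_sum_mono_swap[of _ 1 9] conv_sum_mono_swap[of _ 7 3] by simp
  finally have "10080 * ?U 3 7 + 12600 * ?U 5 5 = 90 * (conv_sum_all ?n (\<lambda>a b. a * b * (a + b) ^ 8)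
      + conv_sum_all ?n (\<lambda>a b. a * b * (a - b) ^ 8) - 4 * ?U 9 1)"
    by simp
  also have "?U 9 1 = conv_sum_all ?n (\<lambda>a b. a * b * a ^ 8)"
    by (rule conv_sum_cong) (simp_all, algebra)
  also have "90 * (conv_sum_all ?n (\<lambda>a b. a * b * (a + b) ^ 8)
      + conv_sum_all ?n (\<lambda>a b. a * b * (a - b) ^ 8) - 4 * conv_sum_all ?n (\<lambda>a b. a * b * a ^ 8)) =
      div_sum ?n (\<lambda>d e. 90 * (d ^ 8 * (\<Sum>a\<in>{1..<d}. a * (d - a)) - 2 * (\<Sum>a\<in>{1..<d}. d * (d - a) * a ^ 8)))"
    by (subst liouville_second[where f = "\<lambda>x. x ^ 8"], simp_all only: div_sum_cmult, simp_all)
  also have "\<dots> = div_sum ?n (\<lambda>d e. 13 * d ^ 11 - 42 * d ^ 7 + 50 * d ^ 5 - 21 * d ^ 3)"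
  proof (rule div_sum_cong)
    fix d e :: int assume d: "0 < d"
    have "90 * (d ^ 8 * (\<Sum>a\<in>{1..<d}. a * (d - a)) - 2 * (\<Sum>a\<in>{1..<d}. d * (d - a) * a ^ 8)) =
      15 * d ^ 8 * (d ^ 3 - d)
        - 2 * d ^ 2 * (10 * d ^ 9 - 45 * d ^ 8 + 60 * d ^ 7 - 42 * d ^ 5 + 20 * d ^ 3 - 3 * d)
        + 9 * d * (2 * d ^ 10 - 10 * d ^ 9 + 15 * d ^ 8 - 14 * d ^ 6 + 10 * d ^ 4 - 3 * d ^ 2)"
      using sum_mult_diff[OF d] sum_power8[OF d] sum_power9[OF d]
      unfolding sum_mult_diff_power by (simp only: Suc_numeral semiring_norm) algebra
    also have "\<dots> = 13 * d ^ 11 - 42 * d ^ 7 + 50 * d ^ 5 - 21 * d ^ 3" by algebra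
    finally show "90 * (d ^ 8 * (\<Sum>a\<in>{1..<d}. a * (d - a)) - 2 * (\<Sum>a\<in>{1..<d}. d * (d - a) * a ^ 8)) =
      13 * d ^ 11 - 42 * d ^ 7 + 50 * d ^ 5 - 21 * d ^ 3" .
  qed
  finally show "(10080 * (S 3 * S 7) + 12600 * S 5 ^ 2) $ m =
      (13 * S 11 - 42 * S 7 + 50 * S 5 - 21 * S 3) $ m"
    by (simp only: power2_eq_square fps_add_nth fps_sub_nth fps_numeral_mult_nth S_mult_nth S_nth
        div_sum_add div_sum_diff div_sum_cmult)
qed

section \<open>Integral Eisenstein series and Ramanujan's formulas\<close>

definition G2 :: "int fps" where "G2 = 1 - 24 * S 1"
definition G4 :: "int fps" where "G4 = 1 + 240 * S 3"
definition G6 :: "int fps" where "G6 = 1 - 504 * S 5"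

lemma euler_add: "euler (f + g) = euler f + euler g"
  by (simp add: euler_def algebra_simps)

lemma euler_mult: "euler (f * g) = euler f * g + f * euler g"
  by (simp add: euler_def algebra_simps)

lemma euler_numeral: "euler (numeral k) = 0"
  by (rule fps_ext) (simp add: euler_nth numeral_fps_const)

lemma euler_numeral_mult: "euler (numeral k * f) = numeral k * euler f"
  by (rule fps_ext) (simp add: euler_nth fps_numeral_mult_nth)

lemma euler_G4: "euler G4 = 240 * euler (S 3)"
  by (rule fps_ext) (simp add: euler_nth G4_def fps_numeral_mult_nth)

lemma euler_G6: "euler G6 = - 504 * euler (S 5)"
  by (rule fps_ext) (simp add: euler_nth G6_def fps_numeral_mult_nth)

lemma G4_sq: "G4 ^ 2 = 1 + 480 * S 7"
proof -
  have "G4 ^ 2 = 1 + 480 * S 3 + 480 * (120 * S 3 ^ 2)"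
    unfolding G4_def by algebra
  then show ?thesis unfolding S3_S3 by algebra
qed

lemma ramanujan_G4: "3 * euler G4 = G2 * G4 - G6"
  unfolding euler_G4 unfolding G2_def G4_def G6_def using S1_S3 by algebra

lemma ramanujan_G6: "2 * euler G6 = G2 * G6 - G4 ^ 2"
  unfolding euler_G6 G4_sq unfolding G2_def G6_def using S1_S5 by algebra

text \<open>The weights 441 and 250 make \<open>S 3 * S 7\<close> and \<open>S 5 ^ 2\<close> appear
  as \<open>5040\<close> times the left-hand side of \<open>S3_S7\<close>; they add up to
  691.\<close>

lemma weight_12: "441 * G4 ^ 3 + 250 * G6 ^ 2 = 691 + 65520 * S 11"
proof -
  have "G4 ^ 3 = G4 * (1 + 480 * S 7)"
    unfolding G4_sq[symmetric] by algebra
  then show ?thesis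
    unfolding G4_def G6_def using S3_S7 by algebra
qed

section \<open>The integral series \<open>K\<close> and divisibility of its derivative by
  936\<close>

text \<open>This is \<open>(7 * G4 ^ 3 + 5 * G6 ^ 2 - 12) / 5040\<close>, expanded so that
  integrality is visible.\<close>

definition K :: "int fps" where
  "K = S 3 - S 5 + 240 * S 3 ^ 2 + 19200 * S 3 ^ 3 + 252 * S 5 ^ 2"

lemma K_eq: "5040 * K + 12 = 7 * G4 ^ 3 + 5 * G6 ^ 2"
  unfolding K_def G4_def G6_def by algebra

lemma euler_K: "5040 * euler K = 7 * G2 * G4 ^ 3 + 5 * G2 * G6 ^ 2 - 12 * G4 ^ 2 * G6"
proof -
  have "5040 * euler K = euler (5040 * K + 12)"
    by (rule fps_ext) (simp add: euler_nth fps_numeral_mult_nth numeral_fps_const)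
  \<comment> \<open>The derivative is grouped so that the left-hand sides of the two Ramanujan
    formulas appear.\<close>
  also have "\<dots> = 7 * G4 ^ 2 * (3 * euler G4) + 5 * G6 * (2 * euler G6)"
    unfolding K_eq power3_eq_cube power2_eq_square euler_add euler_mult euler_numeral
    by algebra
  also have "\<dots> = 7 * G2 * G4 ^ 3 + 5 * G2 * G6 ^ 2 - 12 * G4 ^ 2 * G6"
    unfolding ramanujan_G4 ramanujan_G6 by algebra
  finally show ?thesis .
qed

lemma dvd_13_K: "13 dvd K $ n"
proof -
  \<comment> \<open>Subtracting \<open>weight_12\<close> from 63 times \<open>K_eq\<close> removes
    \<open>G4 ^ 3\<close>. What remains is divisible by 13 because \<open>315 - 250 = 65\<close>,
    \<open>691 - 756 = -65\<close> and \<open>65520 = 13 * 5040\<close>.\<close>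
  have "317520 * K = 13 * (5 * (G6 ^ 2 - 1) + 5040 * S 11)"
    using K_eq weight_12 by algebra
  then have "317520 * K $ n = 13 * (5 * (G6 ^ 2 - 1) + 5040 * S 11) $ n"
    by (metis fps_numeral_mult_nth)
  then have "13 dvd 317520 * K $ n" by simp
  moreover have "coprime 13 (317520 :: int)" by (simp add: coprime_iff_gcd_eq_1 gcd_non_0_int)
  ultimately show ?thesis by (simp add: coprime_dvd_mult_right_iff)
qed

text \<open>The polynomial factors as \<open>d ^ 3 * (d ^ 2 - 1) * (2 * d ^ 2 + 1)\<close>. Modulo
  8, the first factor vanishes for even \<open>d\<close> and the second for odd \<open>d\<close>; if
  3 does not divide \<open>d\<close>, it divides both of the last two factors. The proof checks all
  residues modulo 8 and 9.\<close>

lemma dvd_72_powers: "72 dvd 2 * d ^ 7 - d ^ 3 - d ^ 5" for d :: int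
proof -
  have red: "(2 * d ^ 7 - d ^ 3 - d ^ 5) mod m =
      (2 * (d mod m) ^ 7 - (d mod m) ^ 3 - (d mod m) ^ 5) mod m" for m
    by (intro mod_diff_cong mod_mult_cong refl) (simp_all add: power_mod)
  have "\<forall>r\<in>{0, 1, 2, 3, 4, 5, 6, 7}. (2 * r ^ 7 - r ^ 3 - r ^ 5) mod 8 = (0::int)"
    by simp
  moreover have "d mod 8 \<in> {0, 1, 2, 3, 4, 5, 6, 7}"
    by (simp, presburger)
  ultimately have "(2 * d ^ 7 - d ^ 3 - d ^ 5) mod 8 = 0"
    using red[of 8] by metis
  moreover have "\<forall>r\<in>{0, 1, 2, 3, 4, 5, 6, 7, 8}. (2 * r ^ 7 - r ^ 3 - r ^ 5) mod 9 = (0::int)"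
    by simp
  moreover have "d mod 9 \<in> {0, 1, 2, 3, 4, 5, 6, 7, 8}"
    by (simp, presburger)
  ultimately have "8 dvd 2 * d ^ 7 - d ^ 3 - d ^ 5" "9 dvd 2 * d ^ 7 - d ^ 3 - d ^ 5"
    using red[of 9] by (metis dvd_eq_mod_eq_0)+
  then have "8 * 9 dvd 2 * d ^ 7 - d ^ 3 - d ^ 5"
    by (rule divides_mult) (simp add: coprime_iff_gcd_eq_1 gcd_non_0_int)
  then show ?thesis by simp
qed

lemma dvd_72_euler_K: "72 dvd euler K $ n"
proof -
  \<comment> \<open>By \<open>S3_S3\<close>, \<open>240 * S 3 ^ 2 = 2 * (S 7 - S 3)\<close>.\<close>
  have "K = (2 * S 7 - S 3 - S 5) + 19200 * (S 3 * S 3 * S 3) + 252 * (S 5 * S 5)"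
    unfolding K_def using S3_S3 by algebra
  then have "euler K = euler (2 * S 7 - S 3 - S 5) + euler (19200 * (S 3 * S 3 * S 3)) + euler (252 * (S 5 * S 5))"
    by (simp only: euler_add[symmetric])
  \<comment> \<open>Neither 19200 nor 252 is a multiple of 72, but \<open>57600 = 72 * 800\<close>
    and \<open>504 = 72 * 7\<close> are.\<close>
  also have "euler (19200 * (S 3 * S 3 * S 3)) = 57600 * (S 3 ^ 2 * euler (S 3))"
    unfolding euler_numeral_mult unfolding euler_mult by algebra
  also have "euler (252 * (S 5 * S 5)) = 504 * (S 5 * euler (S 5))"
    unfolding euler_numeral_mult unfolding euler_mult by algebra
  finally have "euler K $ n = int n * div_sum (int n) (\<lambda>d e. 2 * d ^ 7 - d ^ 3 - d ^ 5)
      + 57600 * (S 3 ^ 2 * euler (S 3)) $ n + 504 * (S 5 * euler (S 5)) $ n"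
    by (simp only: fps_add_nth fps_sub_nth euler_nth fps_numeral_mult_nth S_nth div_sum_diff div_sum_cmult)
  moreover have "72 dvd div_sum (int n) (\<lambda>d e. 2 * d ^ 7 - d ^ 3 - d ^ 5)"
    unfolding div_sum_def by (rule dvd_sum) (auto intro: dvd_72_powers)
  ultimately show ?thesis by auto
qed

lemma dvd_936_euler_K: "936 dvd euler K $ n"
proof -
  have "13 dvd euler K $ n"
    using dvd_13_K by (simp add: euler_nth)
  then have "13 * 72 dvd euler K $ n"
    using dvd_72_euler_K by (rule divides_mult) (simp add: coprime_iff_gcd_eq_1 gcd_non_0_int)
  then show ?thesis by simp
qed

section \<open>Transfer to complex power series\<close>

definition complex_fps :: "int fps \<Rightarrow> complex fps" where
  "complex_fps f = Abs_fps (\<lambda>n. of_int (f $ n))"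

lemma complex_fps_nth: "complex_fps f $ n = of_int (f $ n)"
  by (simp add: complex_fps_def)

lemma complex_fps_hom:
  "complex_fps (f + g) = complex_fps f + complex_fps g"
  "complex_fps (f - g) = complex_fps f - complex_fps g"
  "complex_fps (f * g) = complex_fps f * complex_fps g"
  "complex_fps 1 = 1" "complex_fps (numeral k) = numeral k"
  by (rule fps_ext; simp add: complex_fps_nth fps_mult_nth numeral_fps_const)+

lemma complex_fps_power: "complex_fps (f ^ k) = complex_fps f ^ k"
  by (induction k) (simp_all add: complex_fps_hom)

lemma S_nth_divisor_sigma:
  assumes "0 < n"
  shows "S k $ n = int (divisor_sigma k n)"
proof -
  have fst: "nat d dvd n \<and> int (n div nat d) = e" if "0 < d" "0 < e" "d * e = int n" for d e
  proof -
    have "n = nat d * nat e"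
      using that by (metis nat_int nat_mult_distrib less_imp_le)
    with that show ?thesis by simp
  qed
  show ?thesis
    unfolding S_nth div_sum_def divisor_sigma_def of_nat_sum
    by (rule sum.reindex_bij_witness[where i = "\<lambda>d. (int d, int (n div d))" and j = "\<lambda>(d, e). nat d"])
      (use assms in \<open>auto simp: fst div_greater_zero_iff dvd_imp_le intro: dvd_pos_nat simp flip: of_nat_mult\<close>)
qed

lemma S_0: "S k $ 0 = 0"
proof -
  have "{(d, e). 0 < d \<and> 0 < e \<and> d * e = int 0} = {}" by auto
  then show ?thesis unfolding S_nth div_sum_def by (simp only: sum.empty)
qed

lemma sigma_series_eq: "sigma_series k = complex_fps (S k)"
  by (rule fps_ext) (simp add: sigma_series_def complex_fps_nth S_nth_divisor_sigma S_0)

lemma Eisenstein_eq_complex_fps: "E2 = complex_fps G2" "E4 = complex_fps G4" "E6 = complex_fps G6"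
  by (simp_all add: E2_def E4_def E6_def G2_def G4_def G6_def sigma_series_eq complex_fps_hom)

section \<open>The candidate form and its first coefficients\<close>

text \<open>The division is exact by \<open>dvd_936_euler_K\<close>, and 936 is the leading
  coefficient of \<open>euler K\<close>, so the quotient is normalised.\<close>

definition extremal_int :: "int fps" where
  "extremal_int = Abs_fps (\<lambda>n. euler K $ n div 936)"

lemma extremal_int_nth: "936 * extremal_int $ n = int n * K $ n"
  using dvd_936_euler_K[of n] by (simp add: extremal_int_def euler_nth)

text \<open>This is \<open>euler_K\<close> carried over to the complex series, with
  \<open>4717440 = 5040 * 936\<close>.\<close>

lemma extremal_int_eq:
  "4717440 * complex_fps extremal_int = 7 * (E2 * E4 ^ 3) + 5 * (E2 * E6 ^ 2) - 12 * (E4 ^ 2 * E6)"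
proof -
  have "4717440 * extremal_int = 5040 * euler K"
    by (rule fps_ext) (simp add: fps_numeral_mult_nth euler_nth flip: extremal_int_nth)
  then have "complex_fps (4717440 * extremal_int) = complex_fps (7 * G2 * G4 ^ 3 + 5 * G2 * G6 ^ 2 - 12 * G4 ^ 2 * G6)"
    by (simp only: euler_K)
  then show ?thesis
    by (simp only: complex_fps_hom complex_fps_power Eisenstein_eq_complex_fps mult.assoc)
qed

lemma S_1: "S k $ 1 = 1"
proof -
  have "{d. d dvd (1::nat)} = {1}" by auto
  then show ?thesis by (simp add: S_nth_divisor_sigma divisor_sigma_def)
qed

lemma S_2: "S k $ 2 = 1 + 2 ^ k"
proof -
  have "{d. d dvd (2::nat)} = {1, 2}" 
    using two_is_prime_nat by (auto simp: prime_nat_iff)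
  then show ?thesis by (simp add: S_nth_divisor_sigma divisor_sigma_def)
qed

lemma extremal_int_initial: "extremal_int $ 0 = 0" "extremal_int $ 1 = 0" "extremal_int $ 2 = 1"
proof -
  have "K $ 1 = 0"
    by (simp add: K_def fps_mult_nth fps_numeral_mult_nth mult.assoc power2_eq_square power3_eq_cube S_0 S_1[simplified])
  \<comment> \<open>The terms are \<open>9 - 33 + 240 + 252\<close>; the cube of \<open>S 3\<close>
    only starts at the third power.\<close>
  moreover have "K $ 2 = 468"
    by (simp add: K_def fps_mult_nth fps_numeral_mult_nth mult.assoc power2_eq_square power3_eq_cube
       S_0 S_1[simplified] S_2[unfolded numeral_2_eq_2] numeral_2_eq_2)
  ultimately show "extremal_int $ 0 = 0" "extremal_int $ 1 = 0" "extremal_int $ 2 = 1"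
    using extremal_int_nth[of 0] extremal_int_nth[of 1] extremal_int_nth[of 2] by simp_all
qed

lemma subdegree_extremal: "subdegree (complex_fps extremal_int) = 2"
proof (rule subdegreeI)
  fix i :: nat assume "i < 2"
  then have "i = 0 \<or> i = 1" by auto
  then show "complex_fps extremal_int $ i = 0" using extremal_int_initial by (auto simp: complex_fps_nth)
qed (simp add: complex_fps_nth extremal_int_initial)

section \<open>Forms of weight 14 and depth at most 1\<close>

lemma qmf_exponents_1_14: "qmf_exponents 1 14 = {(0, 2, 1), (1, 3, 0), (1, 0, 2)}"
proof -
  have "(a, b, c) \<in> {(0, 2, 1), (1, 3, 0), (1, 0, 2)}"
    if "2 * a + 4 * b + 6 * c = 14" "a \<le> 1" for a b c :: nat
  proof -
    have "b \<le> 3" "c \<le> 2"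
      using that by linarith+
    with that(2) have "a = 0 \<or> a = 1" "b = 0 \<or> b = 1 \<or> b = 2 \<or> b = 3" "c = 0 \<or> c = 1 \<or> c = 2"
      by linarith+
    then show ?thesis
      using that(1) by (elim disjE) simp_all
  qed
  then show ?thesis by (auto simp: qmf_exponents_def)
qed

lemma quasimodular_forms_1_14:
  "f \<in> quasimodular_forms 1 14 \<longleftrightarrow> (\<exists>u v w. f = fps_const u * (E4 ^ 2 * E6)
     + fps_const v * (E2 * E4 ^ 3) + fps_const w * (E2 * E6 ^ 2))"
  (is "?L \<longleftrightarrow> ?R")
proof
  assume ?L
  then show ?R
    unfolding quasimodular_forms_def qmf_exponents_1_14 by (auto simp: mult.assoc add.assoc)
next
  assume ?R
  then obtain u v w where f: "f = fps_const u * (E4 ^ 2 * E6)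
     + fps_const v * (E2 * E4 ^ 3) + fps_const w * (E2 * E6 ^ 2)" by blast
  define p :: "nat \<times> nat \<times> nat \<Rightarrow> complex" where
    "p = (\<lambda>(a, b, c). if a = 0 then u else if b = 3 then v else w)"
  have "f = (\<Sum>(a, b, c)\<in>qmf_exponents 1 14. fps_const (p (a, b, c)) * E2 ^ a * E4 ^ b * E6 ^ c)"
    unfolding qmf_exponents_1_14 by (simp add: f p_def mult.assoc add.assoc)
  then show ?L
    unfolding quasimodular_forms_def by blast
qed

lemma Eisenstein_initial:
  "E2 $ 0 = 1" "E4 $ 0 = 1" "E6 $ 0 = 1" "E2 $ 1 = - 24" "E4 $ 1 = 240" "E6 $ 1 = - 504"
  by (simp_all add: Eisenstein_eq_complex_fps complex_fps_nth G2_def G4_def G6_def fps_numeral_mult_nth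
      S_0 S_1[simplified])

lemma fps_mult_nth_Suc_0: "(f * g) $ Suc 0 = f $ 0 * g $ Suc 0 + f $ Suc 0 * g $ 0"
  by (simp add: fps_mult_nth)

text \<open>The two vanishing conditions are independent linear equations in three coefficients, so
  one free parameter remains.\<close>

lemma quasimodular_form_1_14_multiple:
  assumes "f \<in> quasimodular_forms 1 14" "f $ 0 = 0" "f $ 1 = 0"
  obtains c where "f = fps_const c * complex_fps extremal_int"
proof -
  obtain u v w where f: "f = fps_const u * (E4 ^ 2 * E6)
     + fps_const v * (E2 * E4 ^ 3) + fps_const w * (E2 * E6 ^ 2)"
    using assms(1) unfolding quasimodular_forms_1_14 by blast
  have "u + v + w = 0"
    using assms(2) by (simp add: f Eisenstein_initial power2_eq_square power3_eq_cube)
  \<comment> \<open>The coefficients are \<open>480 - 504\<close>, \<open>-24 + 720\<close> and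
    \<open>-24 - 1008\<close>.\<close>
  moreover have "- 24 * u + 696 * v - 1032 * w = 0"
    using assms(3)
    by (simp add: algebra_simps f Eisenstein_initial Eisenstein_initial[unfolded One_nat_def]
        fps_mult_nth_Suc_0 power2_eq_square power3_eq_cube)
  ultimately have "12 * v = - 7 * u" "12 * w = - 5 * u"
    by algebra+
  then have v: "v = - 7 / 12 * u" and w: "w = - 5 / 12 * u"
    by (simp_all add: field_simps)
  \<comment> \<open>In the generator \<open>E4 ^ 2 * E6\<close> has coefficient -12.\<close>
  let ?c = "- u / 12"
  have "f = fps_const ?c * (7 * (E2 * E4 ^ 3) + 5 * (E2 * E6 ^ 2) - 12 * (E4 ^ 2 * E6))"
    unfolding f v w
    by (rule fps_ext) (simp only: fps_add_nth fps_sub_nth fps_mult_left_const_nth fps_numeral_mult_nth, algebra)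
  also have "\<dots> = fps_const (4717440 * ?c) * complex_fps extremal_int"
    unfolding extremal_int_eq[symmetric]
    by (rule fps_ext) (simp add: fps_numeral_mult_nth)
  finally show ?thesis by (rule that)
qed

lemma extremal_quasimodular: "complex_fps extremal_int \<in> quasimodular_forms 1 14"
  unfolding quasimodular_forms_1_14
proof (intro exI)
  have "complex_fps extremal_int = fps_const (1 / 4717440) * (4717440 * complex_fps extremal_int)"
    by (rule fps_ext) (simp add: fps_numeral_mult_nth)
  also have "\<dots> = fps_const (- 12 / 4717440) * (E4 ^ 2 * E6) + fps_const (7 / 4717440) * (E2 * E4 ^ 3)
      + fps_const (5 / 4717440) * (E2 * E6 ^ 2)"
    unfolding extremal_int_eq
    by (rule fps_ext) (simp only: fps_add_nth fps_sub_nth fps_mult_left_const_nth fps_numeral_mult_nth, simp)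
  finally show "complex_fps extremal_int = \<dots>" .
qed

lemma quasimodular_form_1_14_multiple':
  assumes "f \<in> quasimodular_forms 1 14" "2 \<le> subdegree f"
  obtains c where "f = fps_const c * complex_fps extremal_int"
proof (rule quasimodular_form_1_14_multiple[OF assms(1)])
  show "f $ 0 = 0" "f $ 1 = 0"
    by (rule nth_less_subdegree_zero, use assms(2) in linarith)+
qed

lemma extremal_nonzero: "complex_fps extremal_int \<noteq> 0"
proof
  assume "complex_fps extremal_int = 0"
  with subdegree_extremal show False by simp
qed

lemma subdegree_quasimodular_1_14_le:
  assumes "f \<in> quasimodular_forms 1 14" "f \<noteq> 0"
  shows "subdegree f \<le> 2"
proof (cases "2 \<le> subdegree f")
  case True
  with assms(1) obtain c where c: "f = fps_const c * complex_fps extremal_int"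
    by (rule quasimodular_form_1_14_multiple')
  have "c \<noteq> 0"
  proof
    assume "c = 0"
    with c assms(2) show False by simp
  qed
  show ?thesis
    by (rule subdegree_leI) (simp add: c complex_fps_nth extremal_int_initial \<open>c \<noteq> 0\<close>)
qed simp

lemma is_extremal_extremal_int: "is_extremal 1 14 (complex_fps extremal_int)"
  unfolding is_extremal_def subdegree_extremal
  using extremal_quasimodular extremal_nonzero subdegree_quasimodular_1_14_le by blast

lemma normalised_extremal_1_14: "normalised_extremal 1 14 = complex_fps extremal_int"
  unfolding normalised_extremal_def
proof (rule the_equality)
  show "is_extremal 1 14 (complex_fps extremal_int) \<and> complex_fps extremal_int $ subdegree (complex_fps extremal_int) = 1"
    unfolding subdegree_extremal complex_fps_nth extremal_int_initial by (intro conjI is_extremal_extremal_int of_int_1)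
next
  fix f assume f: "is_extremal 1 14 f \<and> f $ subdegree f = 1"
  then have mem: "f \<in> quasimodular_forms 1 14" and "f \<noteq> 0"
    unfolding is_extremal_def by blast+
  then have le: "subdegree f \<le> 2"
    by (rule subdegree_quasimodular_1_14_le)
  \<comment> \<open>The maximality of \<open>f\<close> is applied to the candidate form, which has
    order 2.\<close>
  have ge: "2 \<le> subdegree f"
    using f extremal_quasimodular extremal_nonzero unfolding is_extremal_def subdegree_extremal[symmetric] by blast
  with mem obtain c where c: "f = fps_const c * complex_fps extremal_int"
    by (rule quasimodular_form_1_14_multiple')
  have "f $ 2 = 1"
    using f le ge by (metis le_antisym)
  then have "c = 1"
    by (simp add: c complex_fps_nth extremal_int_initial)
  then show "f = complex_fps extremal_int" by (simp add: c)
qed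

theorem theorem4:
  "\<forall>n. fps_nth (normalised_extremal 1 14) n \<in> \<int>"
  unfolding normalised_extremal_1_14 complex_fps_nth by simp

end
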